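(* Let $m\ge1$ be an integer and let $F=\{f_i\}_{i=1}^\infty$ be a frame with excess $m$ for a Hilbert space $\mathcal{H}$. Then $F$ satisfies the minimal redundancy condition for every subset $\Lambda\subset\mathbb{N}$ with $|\Lambda|=m$, and thus $F$ is an $m$-erasure robust frame for $\mathcal{H}$.
   Context: A sequence $\{f_i\}_{i\in I}$ in a Hilbert space $\mathcal{H}$ ($I$ countable) is a frame for $\mathcal{H}$ if there are constants $A,B>0$ with $A\|f\|^2\le\sum_{i\in I}|\langle f,f_i\rangle|^2\le B\|f\|^2$ for all $f\in\mathcal{H}$. A frame $F=\{f_i\}_{i=1}^\infty$ has excess $m$ if for every $\Lambda\subset\mathbb{N}$ with $|\Lambda|=m$ there are scalars $a_{ij}$ ($i\in\Lambda$, $j\notin\Lambda$) such that $f_i=\sum_{j\notin\Lambda}a_{ij}f_j$ (norm-convergent series) for all $i\in\Lambda$. $F$ satisfies the minimal redundancy condition (MRC) for a set $\Lambda\subset\mathbb{N}$ if $\overline{\mathrm{span}}\{f_i:i\in\mathbb{N}\setminus\Lambda\}=\mathcal{H}$. $F$ is $m$-erasure robust if for every $\Lambda\subset\mathbb{N}$ with $|\Lambda|=m$ the family $\{f_i\}_{i\in\mathbb{N}\setminus\Lambda}$ is a frame for $\mathcal{H}$. *)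

theory Defs
  imports "HOL-Analysis.Analysis"
begin

text \<open>The scalar field is the reals or the complex numbers; both are treated uniformly by a class of
  real normed fields with a conjugation. By the last axiom the conjugation is determined by
  the norm, and by Gelfand--Mazur there are no instances other than (copies of) these two.\<close>

class real_or_complex = real_normed_field +
  fixes conjg :: "'a \<Rightarrow> 'a"
  assumes conjg_add: "conjg (x + y) = conjg x + conjg y"
    and conjg_mult: "conjg (x * y) = conjg x * conjg y"
    and mult_conjg: "x * conjg x = (norm x)\<^sup>2 *\<^sub>R 1"

instantiation real :: real_or_complex
begin
definition conjg_real :: "real \<Rightarrow> real" where "conjg_real x = x"
instance by standard (auto simp: conjg_real_def power2_eq_square)
end

instantiation complex :: real_or_complex
begin
definition conjg_complex :: "complex \<Rightarrow> complex" where "conjg_complex = cnj"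
instance
proof
  fix x y :: complex
  show "x * conjg x = (norm x)\<^sup>2 *\<^sub>R 1"
    by (simp only: conjg_complex_def complex_norm_square[symmetric] scaleR_conv_of_real mult_1_right)
qed (simp_all add: conjg_complex_def)
end

text \<open>The space is a whole type; its addition, norm, topology and completeness come from the
  class \<^class>\<open>banach\<close>, and the inner product induces that norm. The inner product is linear in
  the first argument.\<close>

locale hilbert_space = vector_space smul
  for smul :: "'k::real_or_complex \<Rightarrow> 'h::banach \<Rightarrow> 'h" +
  fixes ip :: "'h \<Rightarrow> 'h \<Rightarrow> 'k"
  assumes smul_of_real: "smul (of_real r) x = r *\<^sub>R x"
    and ip_add_left: "ip (x + y) z = ip x z + ip y z"
    and ip_smul_left: "ip (smul c x) y = c * ip x y"
    and ip_commute: "ip y x = conjg (ip x y)"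
    and ip_self: "ip x x = of_real ((norm x)\<^sup>2)"

lemma hilbert_space_real:
  "hilbert_space scaleR (inner :: 'h::{real_inner, banach} \<Rightarrow> 'h \<Rightarrow> real)"
  by unfold_locales
    (auto simp: conjg_real_def algebra_simps inner_commute power2_norm_eq_inner)

lemma hilbert_space_complex:
  "hilbert_space ((*) :: complex \<Rightarrow> complex \<Rightarrow> complex) (\<lambda>x y. x * cnj y)"
proof unfold_locales
  fix x :: complex
  show "x * cnj x = of_real ((norm x)\<^sup>2)"
    by (simp only: complex_norm_square[symmetric])
qed (simp_all add: conjg_complex_def distrib_left distrib_right scaleR_conv_of_real)

text \<open>The summability requirement matters: \<^const>\<open>infsum\<close> is \<open>0\<close> on divergent families.\<close>

definition is_frame :: "('h \<Rightarrow> 'h \<Rightarrow> 'k::real_or_complex) \<Rightarrow> ('i \<Rightarrow> 'h::banach) \<Rightarrow> 'i set \<Rightarrow> bool" where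
  "is_frame ip f I \<longleftrightarrow> countable I \<and>
    (\<exists>A>0. \<exists>B>0. \<forall>x.
      (\<lambda>i. (norm (ip x (f i)))\<^sup>2) summable_on I \<and>
      A * (norm x)\<^sup>2 \<le> (\<Sum>\<^sub>\<infinity>i\<in>I. (norm (ip x (f i)))\<^sup>2) \<and>
      (\<Sum>\<^sub>\<infinity>i\<in>I. (norm (ip x (f i)))\<^sup>2) \<le> B * (norm x)\<^sup>2)"

text \<open>The expansions are series in the order of the indices; unconditional convergence is not
  required.\<close>

definition has_excess ::
  "('k::real_or_complex \<Rightarrow> 'h::banach \<Rightarrow> 'h) \<Rightarrow> (nat \<Rightarrow> 'h) \<Rightarrow> nat \<Rightarrow> bool" where
  "has_excess smul f m \<longleftrightarrow>
    (\<forall>\<Lambda>. finite \<Lambda> \<and> card \<Lambda> = m \<longrightarrow>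
      (\<exists>a. \<forall>i\<in>\<Lambda>. (\<lambda>n. \<Sum>j\<in>{..<n} - \<Lambda>. smul (a i j) (f j)) \<longlonglongrightarrow> f i))"

definition satisfies_MRC ::
  "('k::real_or_complex \<Rightarrow> 'h::banach \<Rightarrow> 'h) \<Rightarrow> (nat \<Rightarrow> 'h) \<Rightarrow> nat set \<Rightarrow> bool" where
  "satisfies_MRC smul f \<Lambda> \<longleftrightarrow> closure (module.span smul (f ` (UNIV - \<Lambda>))) = UNIV"

definition erasure_robust ::
  "('h \<Rightarrow> 'h \<Rightarrow> 'k::real_or_complex) \<Rightarrow> (nat \<Rightarrow> 'h::banach) \<Rightarrow> nat \<Rightarrow> bool" where
  "erasure_robust ip f m \<longleftrightarrow>
    (\<forall>\<Lambda>. finite \<Lambda> \<and> card \<Lambda> = m \<longrightarrow> is_frame ip f (UNIV - \<Lambda>))"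

end

theory Submission
  imports Defs
begin

text \<open>By continuity of the inner product, the expansions of the erased vectors show that a vector
  orthogonal to all \<open>f j\<close> with \<open>j \<notin> \<Lambda>\<close> is orthogonal to every \<open>f i\<close>, hence is \<open>0\<close> by the lower
  frame bound; the projection theorem turns this into density of the span. For the frame property
  one erases one vector at a time: a sequence normalised by \<open>\<langle>y n, f i\<rangle> = 1\<close> that violates the
  lower bound of the erased family would be Cauchy by the lower bound of the larger one,
  and its limit would be a nonzero vector orthogonal to the erased family.\<close>

section \<open>Conjugation and sesquilinearity\<close>

lemma conjg_zero [simp]: "conjg (0 :: 'k::real_or_complex) = 0"
  using conjg_add[of "0::'k" 0] by simp

lemma norm_conjg [simp]: "norm (conjg (z :: 'k::real_or_complex)) = norm z"
proof (cases "z = 0")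
  case False
  have "norm z * norm (conjg z) = norm z * norm z"
    by (metis mult_conjg norm_mult norm_scaleR norm_one mult_1_right power2_eq_square
        abs_of_nonneg zero_le_power2)
  with False show ?thesis by simp
qed simp

context hilbert_space
begin

lemma ip_zero_left [simp]: "ip 0 z = 0"
  using ip_add_left[of 0 0 z] by simp

lemma ip_minus_left: "ip (- x) z = - ip x z"
  using ip_add_left[of x "- x" z] by (simp add: eq_neg_iff_add_eq_0 add.commute)

lemma ip_diff_left: "ip (x - y) z = ip x z - ip y z"
  using ip_add_left[of x "- y" z] by (simp add: ip_minus_left)

lemma ip_add_right: "ip x (y + z) = ip x y + ip x z"
  by (metis ip_add_left ip_commute conjg_add)

lemma ip_zero_right [simp]: "ip x 0 = 0"
  using ip_add_right[of x 0 0] by simp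

lemma ip_minus_right: "ip x (- z) = - ip x z"
  using ip_add_right[of x z "- z"] by (simp add: eq_neg_iff_add_eq_0 add.commute)

lemma ip_diff_right: "ip x (y - z) = ip x y - ip x z"
  using ip_add_right[of x y "- z"] by (simp add: ip_minus_right)

lemma ip_smul_right: "ip x (smul c y) = conjg c * ip x y"
  by (metis ip_commute ip_smul_left conjg_mult)

lemma ip_sum_right: "ip x (\<Sum>i\<in>S. g i) = (\<Sum>i\<in>S. ip x (g i))"
  by (induction S rule: infinite_finite_induct) (auto simp: ip_add_right)

section \<open>Norm identities, Cauchy-Schwarz and continuity\<close>

lemma parallelogram_law:
  fixes x y :: 'h
  shows "(norm (x + y))\<^sup>2 + (norm (x - y))\<^sup>2 = 2 * (norm x)\<^sup>2 + 2 * (norm y)\<^sup>2"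
proof -
  \<comment> \<open>The real identity is moved into the scalar field, where \<open>ip_self\<close>
    lets sesquilinearity cancel the cross terms; injectivity of \<open>of_real\<close> brings it
    back.\<close>
  have "of_real ((norm (x + y))\<^sup>2 + (norm (x - y))\<^sup>2)
      = (of_real (2 * (norm x)\<^sup>2 + 2 * (norm y)\<^sup>2) :: 'k)"
    unfolding of_real_add of_real_mult ip_self[symmetric]
    by (simp add: ip_add_left ip_add_right ip_diff_left ip_diff_right)
  then show ?thesis using of_real_eq_iff by blast
qed

text \<open>Pythagoras for \<open>w\<close> minus its component along \<open>v\<close>. The exact
  value yields both Cauchy-Schwarz and the orthogonality of a shortest residual.\<close>

lemma norm_diff_projection:
  assumes "v \<noteq> 0"
  shows "(norm (w - smul (ip w v / of_real ((norm v)\<^sup>2)) v))\<^sup>2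
    = (norm w)\<^sup>2 - (norm (ip w v))\<^sup>2 / (norm v)\<^sup>2"
proof -
  define c where "c = ip w v"
  define s where "s = (of_real ((norm v)\<^sup>2) :: 'k)"
  define t where "t = c / s"
  have s: "s \<noteq> 0" using assms by (simp add: s_def)
  have vw: "ip v w = conjg c" and vv: "ip v v = s"
    using ip_commute[of v w] by (auto simp: c_def s_def ip_self)
  have cc: "c * conjg c = of_real ((norm c)\<^sup>2)"
    using mult_conjg[of c] by (simp add: scaleR_conv_of_real)
  have "ip (w - smul t v) (w - smul t v)
      = ip w w - conjg t * c - t * conjg c + t * conjg t * s"
    by (simp add: ip_diff_left ip_diff_right ip_smul_left ip_smul_right vw vv c_def[symmetric]
        algebra_simps)
  \<comment> \<open>\<open>conjg t\<close> stays unexpanded: its two occurrences cancel, so the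
    conjugate of a quotient is never computed.\<close>
  also have "t * conjg t * s = conjg t * c"
    using s by (simp add: t_def)
  also have "ip w w - conjg t * c - t * conjg c + conjg t * c = ip w w - (c * conjg c) / s"
    by (simp add: t_def)
  also have "\<dots> = of_real ((norm w)\<^sup>2 - (norm c)\<^sup>2 / (norm v)\<^sup>2)"
    by (simp add: cc ip_self s_def)
  finally have "(of_real ((norm (w - smul t v))\<^sup>2) :: 'k)
      = of_real ((norm w)\<^sup>2 - (norm c)\<^sup>2 / (norm v)\<^sup>2)"
    by (simp only: ip_self)
  then show ?thesis
    unfolding of_real_eq_iff t_def c_def s_def .
qed

text \<open>Cauchy-Schwarz: the squared norm in \<open>norm_diff_projection\<close> is
  nonnegative.\<close>

lemma norm_ip_le: "norm (ip w v) \<le> norm w * norm v"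
proof (cases "v = 0")
  case False
  have "0 \<le> (norm w)\<^sup>2 - (norm (ip w v))\<^sup>2 / (norm v)\<^sup>2"
    unfolding norm_diff_projection[OF False, symmetric] by simp
  with False have "(norm (ip w v))\<^sup>2 \<le> (norm w * norm v)\<^sup>2"
    by (simp add: field_simps power_mult_distrib)
  then show ?thesis by (rule power2_le_imp_le) simp
qed simp

text \<open>If \<open>ip w v\<close> were nonzero, subtracting the component along \<open>v\<close>
  would make \<open>w\<close> strictly shorter.\<close>

lemma orthogonal_if_norm_minimal:
  assumes "\<And>t. norm w \<le> norm (w - smul t v)"
  shows "ip w v = 0"
proof (cases "v = 0")
  case False
  have "(norm w)\<^sup>2 \<le> (norm w)\<^sup>2 - (norm (ip w v))\<^sup>2 / (norm v)\<^sup>2"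
    unfolding norm_diff_projection[OF False, symmetric] using assms by (simp add: power_mono)
  with False show ?thesis by (simp add: divide_le_0_iff)
qed simp

text \<open>Cauchy-Schwarz applied to the difference. This slot serves limits of vectors tested
  against the frame; the other slot serves the series expansions.\<close>

lemma tendsto_ip_left: "X \<longlonglongrightarrow> x \<Longrightarrow> (\<lambda>n. ip (X n) y) \<longlonglongrightarrow> ip x y"
proof (rule Lim_transform_bound[THEN LIM_zero_cancel])
  assume "X \<longlonglongrightarrow> x"
  then show "(\<lambda>n. norm (X n - x) * norm y) \<longlonglongrightarrow> 0"
    by (intro tendsto_mult_left_zero tendsto_norm_zero LIM_zero)
  show "\<forall>\<^sub>F n in sequentially. norm (ip (X n) y - ip x y) \<le> norm (norm (X n - x) * norm y)"
    using norm_ip_le by (simp add: ip_diff_left[symmetric] abs_mult)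
qed

lemma tendsto_ip_right: "X \<longlonglongrightarrow> x \<Longrightarrow> (\<lambda>n. ip y (X n)) \<longlonglongrightarrow> ip y x"
proof (rule Lim_transform_bound[THEN LIM_zero_cancel])
  assume "X \<longlonglongrightarrow> x"
  then show "(\<lambda>n. norm y * norm (X n - x)) \<longlonglongrightarrow> 0"
    by (intro tendsto_mult_right_zero tendsto_norm_zero LIM_zero)
  show "\<forall>\<^sub>F n in sequentially. norm (ip y (X n) - ip y x) \<le> norm (norm y * norm (X n - x))"
    using norm_ip_le by (simp add: ip_diff_right[symmetric] abs_mult)
qed

section \<open>Orthogonal projection and density\<close>

lemma ex_orthogonal_projection:
  assumes "subspace V"
  obtains y where "y \<in> closure V" "\<And>v. v \<in> V \<Longrightarrow> ip (x - y) v = 0"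
proof -
  define d where "d = infdist x V"
  have ne: "V \<noteq> {}" using subspace_0[OF assms] by auto
  have d_le: "d \<le> norm (x - v)" if "v \<in> V" for v
    using infdist_le[OF that, of x] by (simp add: d_def dist_norm)
  have d0: "0 \<le> d" by (simp add: d_def infdist_nonneg)
  have "\<exists>v\<in>V. norm (x - v) < d + e" if "e > 0" for e
    using cINF_less_iff[OF ne bdd_below_image_dist, of x "d + e"] that ne
    by (simp add: d_def infdist_notempty dist_norm)
  then have "\<forall>n. \<exists>v\<in>V. norm (x - v) < d + 1 / real (Suc n)" by simp
  then obtain v where v: "\<And>n. v n \<in> V" "\<And>n. norm (x - v n) < d + 1 / real (Suc n)"
    by metis
  have lim: "(\<lambda>n. norm (x - v n)) \<longlonglongrightarrow> d"
  proof (rule tendsto_sandwich)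
    show "(\<lambda>n. d) \<longlonglongrightarrow> d" by simp
    show "(\<lambda>n. d + 1 / real (Suc n)) \<longlonglongrightarrow> d"
      using tendsto_add[OF tendsto_const LIMSEQ_inverse_real_of_nat, of d]
      by (simp add: inverse_eq_divide)
    show "\<forall>\<^sub>F n in sequentially. norm (x - v n) \<le> d + 1 / real (Suc n)"
      using v(2) by (intro always_eventually allI less_imp_le)
  qed (use d_le v(1) in auto)
  \<comment> \<open>Parallelogram law for the two residuals: the midpoint \<open>u\<close> of
    \<open>v i\<close> and \<open>v j\<close> lies in \<open>V\<close>, so it is at distance at
    least \<open>d\<close> from \<open>x\<close>.\<close>
  have gap: "(norm (v i - v j))\<^sup>2
      \<le> 2 * ((norm (x - v i))\<^sup>2 - d\<^sup>2) + 2 * ((norm (x - v j))\<^sup>2 - d\<^sup>2)" for i j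
  proof -
    define u where "u = smul (of_real (1/2)) (v i + v j)"
    have "u \<in> V" unfolding u_def using assms v by (intro subspace_scale subspace_add) auto
    have "(x - v i) + (x - v j) = 2 *\<^sub>R (x - u)"
      unfolding u_def smul_of_real by (simp add: algebra_simps scaleR_2)
    then have "norm ((x - v i) + (x - v j)) = 2 * norm (x - u)" by simp
    moreover have "d\<^sup>2 \<le> (norm (x - u))\<^sup>2"
      using d_le[OF \<open>u \<in> V\<close>] d0 by (simp add: power_mono)
    moreover have "norm ((x - v i) - (x - v j)) = norm (v i - v j)"
      by (simp add: norm_minus_commute)
    ultimately show ?thesis
      using parallelogram_law[of "x - v i" "x - v j"] by (simp add: power_mult_distrib)
  qed
  have "Cauchy v"
  proof (rule CauchyI)
    fix e :: real assume e: "e > 0"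
    have "(\<lambda>n. (norm (x - v n))\<^sup>2 - d\<^sup>2) \<longlonglongrightarrow> d\<^sup>2 - d\<^sup>2"
      by (intro tendsto_intros lim)
    \<comment> \<open>With this bound each of the two terms of \<open>gap\<close> contributes less
      than half of \<open>e\<^sup>2\<close>.\<close>
    then have "\<forall>\<^sub>F n in sequentially. (norm (x - v n))\<^sup>2 - d\<^sup>2 < e\<^sup>2 / 4"
      using e by (intro order_tendstoD(2)) auto
    then obtain M where M: "\<And>n. n \<ge> M \<Longrightarrow> (norm (x - v n))\<^sup>2 - d\<^sup>2 < e\<^sup>2 / 4"
      by (auto simp: eventually_sequentially)
    have "norm (v i - v j) < e" if "i \<ge> M" "j \<ge> M" for i j
    proof (rule power2_less_imp_less)
      show "(norm (v i - v j))\<^sup>2 < e\<^sup>2"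
        using gap[of i j] M[OF that(1)] M[OF that(2)] by (simp add: field_simps)
    qed (use e in simp)
    then show "\<exists>M. \<forall>m\<ge>M. \<forall>n\<ge>M. norm (v m - v n) < e" by blast
  qed
  then obtain y where y: "v \<longlonglongrightarrow> y"
    using Cauchy_convergent_iff convergent_def by blast
  show thesis
  proof
    show "y \<in> closure V" using v(1) y closure_sequential by blast
    have "norm (x - y) = d"
      by (rule LIMSEQ_unique[OF _ lim]) (intro tendsto_intros y)
    \<comment> \<open>\<open>y\<close> itself may lie outside \<open>V\<close>, so the bound is
      proved for \<open>v n + smul t u\<close>, which is in \<open>V\<close>, and passed to the
      limit.\<close>
    moreover have "d \<le> norm (x - y - smul t u)" if "u \<in> V" for t u
    proof (rule LIMSEQ_le_const)
      show "(\<lambda>n. norm (x - v n - smul t u)) \<longlonglongrightarrow> norm (x - y - smul t u)"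
        by (intro tendsto_intros y)
      have "v n + smul t u \<in> V" for n
        using assms v that by (intro subspace_scale subspace_add) auto
      then show "\<exists>N. \<forall>n\<ge>N. d \<le> norm (x - v n - smul t u)"
        using d_le by (metis diff_diff_add)
    qed
    ultimately show "ip (x - y) u = 0" if "u \<in> V" for u
      using that by (intro orthogonal_if_norm_minimal) auto
  qed
qed

text \<open>The residual of \<open>x\<close> after projection onto the closed span is orthogonal to
  \<open>G\<close>, hence zero.\<close>

lemma dense_span_if_total:
  assumes "\<And>x. (\<And>g. g \<in> G \<Longrightarrow> ip x g = 0) \<Longrightarrow> x = 0"
  shows "closure (span G) = UNIV"
proof -
  have "x \<in> closure (span G)" for x
  proof -
    obtain y where "y \<in> closure (span G)" "\<And>v. v \<in> span G \<Longrightarrow> ip (x - y) v = 0"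
      using ex_orthogonal_projection[OF subspace_span] by metis
    moreover from this(2) have "x - y = 0" by (intro assms) (simp add: span_base)
    ultimately show ?thesis by simp
  qed
  then show ?thesis by blast
qed

section \<open>Frames and erasures\<close>

lemma frame_total:
  assumes "is_frame ip f I" "\<And>i. i \<in> I \<Longrightarrow> ip x (f i) = 0"
  shows "x = 0"
proof -
  obtain A where A: "A > 0" "A * (norm x)\<^sup>2 \<le> (\<Sum>\<^sub>\<infinity>i\<in>I. (norm (ip x (f i)))\<^sup>2)"
    using assms(1) unfolding is_frame_def by blast
  have "(\<Sum>\<^sub>\<infinity>i\<in>I. (norm (ip x (f i)))\<^sup>2) = 0"
    using assms(2) by (intro infsum_0) simp
  with A show ?thesis by (simp add: mult_le_0_iff)
qed

text \<open>The upper bound is inherited. For the lower one, the erased coefficient has to be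
  controlled by the remaining ones, that is, by \<open>N\<close>; completeness turns the qualitative
  hypothesis \<open>total\<close> into such an estimate.\<close>

lemma is_frame_remove1:
  assumes frame: "is_frame ip f I" and i: "i \<in> I"
    and total: "\<And>x. (\<And>j. j \<in> I - {i} \<Longrightarrow> ip x (f j) = 0) \<Longrightarrow> x = 0"
  shows "is_frame ip f (I - {i})"
proof -
  obtain A B where AB: "A > 0" "B > 0"
    and sumI: "\<And>x. (\<lambda>i. (norm (ip x (f i)))\<^sup>2) summable_on I"
    and lower: "\<And>x. A * (norm x)\<^sup>2 \<le> (\<Sum>\<^sub>\<infinity>i\<in>I. (norm (ip x (f i)))\<^sup>2)"
    and upper: "\<And>x. (\<Sum>\<^sub>\<infinity>i\<in>I. (norm (ip x (f i)))\<^sup>2) \<le> B * (norm x)\<^sup>2"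
    using frame unfolding is_frame_def by metis
  define N where "N x = (\<Sum>\<^sub>\<infinity>j\<in>I - {i}. (norm (ip x (f j)))\<^sup>2)" for x
  have sumJ: "(\<lambda>j. (norm (ip x (f j)))\<^sup>2) summable_on I - {i}" for x
    using summable_on_subset_banach[OF sumI] by blast
  have N_nonneg: "0 \<le> N x" for x unfolding N_def by (intro infsum_nonneg) simp
  have split: "(\<Sum>\<^sub>\<infinity>j\<in>I. (norm (ip x (f j)))\<^sup>2) = (norm (ip x (f i)))\<^sup>2 + N x" for x
    using infsum_insert[OF sumJ, of i x] i by (simp add: N_def insert_absorb)
  have term_le: "(norm (ip x (f j)))\<^sup>2 \<le> N x" if "j \<in> I - {i}" for x j
    using finite_sum_le_infsum[OF sumJ, of "{j}" x] that by (simp add: N_def)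
  have N_smul: "N (smul c x) = (norm c)\<^sup>2 * N x" for c x
    unfolding N_def ip_smul_left norm_mult power_mult_distrib
    by (intro infsum_cmult_right sumJ)
  \<comment> \<open>A substitute for the triangle inequality of the seminorm whose square is
    \<open>N\<close>; termwise it is \<open>(a - b)\<^sup>2 \<ge> 0\<close>.\<close>
  have N_diff: "N (x - y) \<le> 2 * N x + 2 * N y" for x y
  proof -
    have le: "(norm (ip (x - y) (f j)))\<^sup>2 \<le> 2 * (norm (ip x (f j)))\<^sup>2 + 2 * (norm (ip y (f j)))\<^sup>2" for j
    proof -
      define a b where "a = norm (ip x (f j))" and "b = norm (ip y (f j))"
      have "(norm (ip (x - y) (f j)))\<^sup>2 \<le> (a + b)\<^sup>2"
        unfolding ip_diff_left a_def b_def by (intro power_mono norm_triangle_ineq4) simp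
      also have "\<dots> \<le> 2 * a\<^sup>2 + 2 * b\<^sup>2"
        using zero_le_power2[of "a - b"] unfolding power2_sum power2_diff by linarith
      finally show ?thesis by (simp add: a_def b_def)
    qed
    have "N (x - y) \<le> (\<Sum>\<^sub>\<infinity>j\<in>I - {i}. 2 * (norm (ip x (f j)))\<^sup>2 + 2 * (norm (ip y (f j)))\<^sup>2)"
      unfolding N_def by (intro infsum_mono sumJ summable_on_add summable_on_cmult_right le)
    also have "\<dots> = 2 * N x + 2 * N y"
      unfolding N_def
      by (simp add: infsum_add summable_on_cmult_right sumJ infsum_cmult_right)
    finally show ?thesis .
  qed
  have "\<exists>e>0. \<forall>y. ip y (f i) = 1 \<longrightarrow> e \<le> N y"
  proof (rule ccontr)
    assume "\<not> ?thesis"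
    then have "\<forall>n. \<exists>y. ip y (f i) = 1 \<and> N y < inverse (real (Suc n))"
      by (metis inverse_positive_iff_positive not_le of_nat_0_less_iff zero_less_Suc)
    then obtain y where y1: "\<And>n. ip (y n) (f i) = 1"
      and yN: "\<And>n. N (y n) < inverse (real (Suc n))"
      by metis
    have lim: "(\<lambda>n. N (y n)) \<longlonglongrightarrow> 0"
      using yN N_nonneg
      by (intro tendsto_sandwich[OF _ _ tendsto_const LIMSEQ_inverse_real_of_nat])
        (auto intro!: always_eventually less_imp_le)
    have "Cauchy y"
    proof (rule CauchyI)
      fix e :: real assume e: "e > 0"
      have "\<forall>\<^sub>F n in sequentially. N (y n) < A * e\<^sup>2 / 4"
        using lim e AB by (intro order_tendstoD(2)) auto
      then obtain M where M: "\<And>n. n \<ge> M \<Longrightarrow> N (y n) < A * e\<^sup>2 / 4"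
        by (auto simp: eventually_sequentially)
      have "norm (y k - y l) < e" if "k \<ge> M" "l \<ge> M" for k l
      proof (rule power2_less_imp_less)
        \<comment> \<open>By the normalisation the difference has zero coefficient at
          \<open>f i\<close>, so the frame sum over \<open>I\<close> reduces to
          \<open>N\<close>.\<close>
        have "A * (norm (y k - y l))\<^sup>2 \<le> N (y k - y l)"
          using lower[of "y k - y l"] unfolding split by (simp add: ip_diff_left y1)
        also have "\<dots> < A * e\<^sup>2"
          using N_diff[of "y k" "y l"] M[OF that(1)] M[OF that(2)] by linarith
        finally show "(norm (y k - y l))\<^sup>2 < e\<^sup>2" using AB by simp
      qed (use e in simp)
      then show "\<exists>M. \<forall>m\<ge>M. \<forall>n\<ge>M. norm (y m - y n) < e" by blast
    qed
    then obtain z where z: "y \<longlonglongrightarrow> z"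
      using Cauchy_convergent_iff convergent_def by blast
    have "z = 0"
    proof (rule total)
      fix j assume j: "j \<in> I - {i}"
      have "(\<lambda>n. (norm (ip (y n) (f j)))\<^sup>2) \<longlonglongrightarrow> 0"
        using term_le[OF j] by (intro tendsto_sandwich[OF _ _ tendsto_const lim]) auto
      moreover have "(\<lambda>n. (norm (ip (y n) (f j)))\<^sup>2) \<longlonglongrightarrow> (norm (ip z (f j)))\<^sup>2"
        by (intro tendsto_intros tendsto_ip_left z)
      ultimately have "(norm (ip z (f j)))\<^sup>2 = 0" by (rule LIMSEQ_unique[symmetric])
      then show "ip z (f j) = 0" by simp
    qed
    \<comment> \<open>The normalisation survives the limit, which is incompatible with
      \<open>z = 0\<close>.\<close>
    moreover have "ip z (f i) = 1"
      using LIMSEQ_unique[OF tendsto_ip_left[OF z, of "f i"]] by (simp add: y1)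
    ultimately show False by simp
  qed
  then obtain e where e: "e > 0" "\<And>y. ip y (f i) = 1 \<Longrightarrow> e \<le> N y" by blast
  \<comment> \<open>By homogeneity: scale \<open>x\<close> to coefficient 1 at \<open>f i\<close>; a
    zero coefficient leaves only \<open>N x \<ge> 0\<close>.\<close>
  have le_N: "e * (norm (ip x (f i)))\<^sup>2 \<le> N x" for x
  proof (cases "ip x (f i) = 0")
    case False
    then have "e \<le> N (smul (inverse (ip x (f i))) x)"
      by (intro e) (simp add: ip_smul_left)
    also have "\<dots> = N x / (norm (ip x (f i)))\<^sup>2"
      by (simp add: N_smul norm_inverse power_inverse divide_inverse mult.commute)
    finally show ?thesis using False by (simp add: field_simps)
  qed (use N_nonneg in simp)
  \<comment> \<open>The erased term is at most \<open>N x / e\<close>, so the full frame sum is at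
    most \<open>(1 + 1 / e) * N x\<close>.\<close>
  have "A / (1 + 1 / e) * (norm x)\<^sup>2 \<le> N x" for x
  proof -
    have "A * (norm x)\<^sup>2 \<le> (norm (ip x (f i)))\<^sup>2 + N x" using lower split by metis
    also have "\<dots> \<le> N x / e + N x" using le_N[of x] e(1) by (simp add: field_simps)
    also have "\<dots> = (1 + 1 / e) * N x" by (simp add: algebra_simps)
    finally show ?thesis
      using e(1) by (simp add: pos_divide_le_eq add_pos_pos mult.commute)
  qed
  moreover have "N x \<le> B * (norm x)\<^sup>2" for x
    using upper[of x] split[of x] zero_le_power2[of "norm (ip x (f i))"] by linarith
  moreover have "A / (1 + 1 / e) > 0" using AB e(1) by (simp add: add_pos_pos)
  moreover have "countable (I - {i})" using frame by (simp add: is_frame_def)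
  ultimately show ?thesis
    unfolding is_frame_def using AB(2) sumJ by (metis N_def)
qed

text \<open>Totality passes to larger families, so it holds at each intermediate stage and
  \<open>is_frame_remove1\<close> can be iterated.\<close>

lemma is_frame_remove_finite:
  assumes "is_frame ip f I" "finite \<Lambda>" "\<Lambda> \<subseteq> I"
    and "\<And>x. (\<And>j. j \<in> I - \<Lambda> \<Longrightarrow> ip x (f j) = 0) \<Longrightarrow> x = 0"
  shows "is_frame ip f (I - \<Lambda>)"
  using assms(2-4)
proof (induction \<Lambda> rule: finite_induct)
  case (insert i \<Lambda>)
  have "is_frame ip f (I - \<Lambda>)"
    using insert.prems by (intro insert.IH) auto
  then have "is_frame ip f (I - \<Lambda> - {i})"
    using insert by (intro is_frame_remove1) auto
  then show ?case by (metis Diff_insert)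
qed (use assms(1) in simp)

lemma total_outside_if_has_excess:
  assumes "is_frame ip f UNIV" "has_excess smul f m" "finite \<Lambda>" "card \<Lambda> = m"
    and orth: "\<And>j. j \<notin> \<Lambda> \<Longrightarrow> ip x (f j) = 0"
  shows "x = 0"
proof (rule frame_total[OF assms(1)])
  fix i
  show "ip x (f i) = 0"
  proof (cases "i \<in> \<Lambda>")
    case True
    obtain a where "(\<lambda>n. \<Sum>j\<in>{..<n} - \<Lambda>. smul (a i j) (f j)) \<longlonglongrightarrow> f i"
      using assms(2-4) True unfolding has_excess_def by blast
    \<comment> \<open>Every partial sum uses only indices outside \<open>\<Lambda>\<close>, so its
      inner product with \<open>x\<close> is already 0; convergence in the given order is
      enough.\<close>
    from tendsto_ip_right[OF this, of x] have "(\<lambda>n. 0) \<longlonglongrightarrow> ip x (f i)"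
      by (simp add: ip_sum_right ip_smul_right orth)
    then show ?thesis using LIMSEQ_unique tendsto_const by blast
  qed (rule orth)
qed

end

theorem corollary4p6:
  fixes smul :: "'k::real_or_complex \<Rightarrow> 'h::banach \<Rightarrow> 'h"
    and ip :: "'h \<Rightarrow> 'h \<Rightarrow> 'k"
    and f :: "nat \<Rightarrow> 'h"
    and m :: nat
  assumes "hilbert_space smul ip"
    and "m \<ge> 1"
    and "is_frame ip f UNIV"
    and "has_excess smul f m"
  shows "(\<forall>\<Lambda>. finite \<Lambda> \<and> card \<Lambda> = m \<longrightarrow> satisfies_MRC smul f \<Lambda>) \<and> erasure_robust ip f m"
proof -
  interpret hilbert_space smul ip by fact
  \<comment> \<open>This totality gives both conclusions: density of the span and the hypothesis for
    erasing \<open>\<Lambda>\<close>.\<close>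
  have total: "x = 0" if "finite \<Lambda>" "card \<Lambda> = m" "\<And>j. j \<in> UNIV - \<Lambda> \<Longrightarrow> ip x (f j) = 0" for \<Lambda> x
    using total_outside_if_has_excess[OF assms(3,4) that(1,2)] that(3) by blast
  have "satisfies_MRC smul f \<Lambda>" if "finite \<Lambda>" "card \<Lambda> = m" for \<Lambda>
    unfolding satisfies_MRC_def using total[OF that] by (intro dense_span_if_total) blast
  moreover have "is_frame ip f (UNIV - \<Lambda>)" if "finite \<Lambda>" "card \<Lambda> = m" for \<Lambda>
    using total[OF that] that(1) by (intro is_frame_remove_finite assms(3)) auto
  ultimately show ?thesis unfolding erasure_robust_def by blast
qed

end
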